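(* Let $N \ge 0$ be an integer. If $\Phi = \{\Phi_t\}_{t\ge 0}$ is a renormalizable flow map that is an $N$-level regularization of the ideal dyadic shell model, then $\mathcal{R}[\Phi] = \{\mathcal{R}[\Phi]_t\}_{t \ge 0}$ is an $(N+1)$-level regularization of the ideal dyadic shell model.
   Context: **Ideal model.** Fix $\lambda = 2$ and $k_n = \lambda^n$. The ideal dyadic shell model for real shell variables $u_n(t)$, $n\ge 1$, $t \ge 0$, is the system $$\frac{du_n}{dt} = k_n f(u_{n-1},u_n,u_{n+1}), \quad n \ge 1, \qquad f(x,y,z) = x^2 - \lambda\, y z,$$ with initial conditions $u_n(0) = a_n$ for $n \ge 1$ and boundary condition $u_0(t) = b(t)$ for $t \ge 0$. Here $b \in C^1$ is a continuously differentiable real function on $[0,\infty)$. Write $u = (u_n)_{n\ge1}$ and $a = (a_n)_{n\ge 1}$. The sequences $a$ and $u(t)$ are real and square-summable. **Scaling operators.** For a sequence $a = (a_1,a_2,\ldots)$ define $$S^+a = (\lambda a_2,\lambda a_3,\lambda a_4,\ldots), \qquad S^-a = (0,a_1/\lambda,a_2/\lambda,\ldots).$$ **Flow maps (regularizations).** A regularization (flow map) is a family $\Phi = \{\Phi_t\}_{t\ge 0}$ of maps. Each $\Phi_t$ assigns to a pair $(a,b)$, consisting of an initial condition $a$ (a square-summable real sequence) and a boundary function $b \in C^1$, a square-summable real sequence $u(t) = \Phi_t(a,b)$. The following properties are required: 1. Initial condition: $\Phi_0(a,b) = a$. 2. Causality: $\Phi_t(a,b)$ depends on $b$ only through its restriction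 to $[0,t]$. 3. Semigroup-type relation: $\Phi_{t+s}(a,b) = \Phi_s(a',b')$ for all $t,s\ge 0$, where $a' = \Phi_t(a,b)$ and $b'(t') = b(t+t')$. **$N$-level regularization.** A regularization $\Phi$ is an $N$-level regularization if, for all $a$ and $b$, the solution $u(t) = \Phi_t(a,b)$ (with $u_0(t) = b(t)$) satisfies the ideal equations $\frac{du_n}{dt} = k_n f(u_{n-1},u_n,u_{n+1})$ for the shells $n = 1,\ldots,N$ (no condition if $N=0$). **Renormalizable flow maps and the RG operator.** A flow map $\Phi$ is called renormalizable if, for any $a$ and $b$, there exists a unique solution $u_1(t)$, $t \ge 0$ (a continuously differentiable real function), of the initial value problem $$\frac{du_1}{dt} = k_1 f(b,u_1,u_2), \qquad u_1(0) = a_1,$$ where $u_2(t) = \tilde u_1(t)/\lambda$ with $$\tilde u(t) = \Phi_t(\tilde a,\tilde b), \qquad \tilde a = S^+ a, \qquad \tilde b(t) = \lambda u_1(t).$$ (Thus $u_2$ depends on the unknown function $u_1$ through $\tilde b$.) For a renormalizable flow map $\Phi$, the RG operator $\mathcal{R}$ is defined by $$\mathcal{R}[\Phi]_t(a,b) = S^-\tilde u(t) + (u_1(t),0,0,\ldots) = \big(u_1(t),\, \tilde u_1(t)/\lambda,\, \tilde u_2(t)/\lambda,\ldots\big),$$ where $u_1$ and $\tilde u$ are those given by the unique solution above. *)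

theory Defs
  imports "HOL-Analysis.Analysis" "HOL-Library.FuncSet"
begin

(* A sequence (a_1, a_2, ...) over the shells n >= 1 is a function a :: nat => real
   whose value a m is the entry for shell m + 1. *)

definition lam :: real where
  "lam = 2"

definition wavenumber :: "nat \<Rightarrow> real" where
  "wavenumber n = lam ^ n"

definition dyadic :: "real \<Rightarrow> real \<Rightarrow> real \<Rightarrow> real" where
  "dyadic x y z = x\<^sup>2 - lam * y * z"

definition square_summable :: "(nat \<Rightarrow> real) set" where
  "square_summable = {a. summable (\<lambda>m. (a m)\<^sup>2)}"

(* Functions on the half-line [0, \<infinity>) are total functions on the reals whose values at
   negative times carry no meaning; derivatives at time 0 are one-sided. *)

definition C1_halfline :: "(real \<Rightarrow> real) set" where
  "C1_halfline = {g. \<exists>g'. continuous_on {0..} g' \<and>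
     (\<forall>t\<ge>0. (g has_real_derivative g' t) (at t within {0..}))}"

definition scale_up :: "(nat \<Rightarrow> real) \<Rightarrow> nat \<Rightarrow> real" where
  "scale_up a m = lam * a (Suc m)"

definition scale_down :: "(nat \<Rightarrow> real) \<Rightarrow> nat \<Rightarrow> real" where
  "scale_down a m = (case m of 0 \<Rightarrow> 0 | Suc j \<Rightarrow> a j / lam)"

(* The variable u_n for n >= 0, given the boundary value u_0 and the sequence u = (u_1, ...). *)

definition shell :: "real \<Rightarrow> (nat \<Rightarrow> real) \<Rightarrow> nat \<Rightarrow> real" where
  "shell u0 u n = (case n of 0 \<Rightarrow> u0 | Suc m \<Rightarrow> u m)"

(* \<Phi> t a b; only t >= 0, square-summable a and continuously differentiable b are relevant. *)

type_synonym flow = "real \<Rightarrow> (nat \<Rightarrow> real) \<Rightarrow> (real \<Rightarrow> real) \<Rightarrow> nat \<Rightarrow> real"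

(* Causality for b and b2 agreeing on [0, t] also makes \<Phi> t a b independent of the values
   of b at negative times. *)

definition flow_map :: "flow \<Rightarrow> bool" where
  "flow_map \<Phi> \<longleftrightarrow>
     (\<forall>t\<ge>0. \<forall>a\<in>square_summable. \<forall>b\<in>C1_halfline. \<Phi> t a b \<in> square_summable) \<and>
     (\<forall>a\<in>square_summable. \<forall>b\<in>C1_halfline. \<Phi> 0 a b = a) \<and>
     (\<forall>t\<ge>0. \<forall>a\<in>square_summable. \<forall>b\<in>C1_halfline. \<forall>b2\<in>C1_halfline.
        (\<forall>s\<in>{0..t}. b s = b2 s) \<longrightarrow> \<Phi> t a b = \<Phi> t a b2) \<and>
     (\<forall>t\<ge>0. \<forall>s\<ge>0. \<forall>a\<in>square_summable. \<forall>b\<in>C1_halfline.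
        \<Phi> (t + s) a b = \<Phi> s (\<Phi> t a b) (\<lambda>r. b (t + r)))"

definition level_regularization :: "nat \<Rightarrow> flow \<Rightarrow> bool" where
  "level_regularization N \<Phi> \<longleftrightarrow> flow_map \<Phi> \<and>
     (\<forall>a\<in>square_summable. \<forall>b\<in>C1_halfline. \<forall>n\<in>{1..N}. \<forall>t\<ge>0.
        let u = (\<lambda>n s. shell (b s) (\<Phi> s a b) n) in
        (u n has_real_derivative
           wavenumber n * dyadic (u (n - 1) t) (u n t) (u (n + 1) t)) (at t within {0..}))"

definition inner_flow :: "flow \<Rightarrow> (nat \<Rightarrow> real) \<Rightarrow> (real \<Rightarrow> real) \<Rightarrow> real \<Rightarrow> nat \<Rightarrow> real" where
  "inner_flow \<Phi> a u1 t = \<Phi> t (scale_up a) (\<lambda>s. lam * u1 s)"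

(* Membership in extensional {0..} fixes the meaningless values at negative times, so that
   uniqueness as a function on the reals is uniqueness as a function on [0, \<infinity>). *)

definition first_shell_solution ::
  "flow \<Rightarrow> (nat \<Rightarrow> real) \<Rightarrow> (real \<Rightarrow> real) \<Rightarrow> (real \<Rightarrow> real) \<Rightarrow> bool" where
  "first_shell_solution \<Phi> a b u1 \<longleftrightarrow>
     u1 \<in> C1_halfline \<and> u1 \<in> extensional {0..} \<and> u1 0 = a 0 \<and>
     (\<forall>t\<ge>0. (u1 has_real_derivative
        wavenumber 1 * dyadic (b t) (u1 t) (inner_flow \<Phi> a u1 t 0 / lam)) (at t within {0..}))"

definition renormalizable :: "flow \<Rightarrow> bool" where
  "renormalizable \<Phi> \<longleftrightarrow> flow_map \<Phi> \<and>
     (\<forall>a\<in>square_summable. \<forall>b\<in>C1_halfline. \<exists>!u1. first_shell_solution \<Phi> a b u1)"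

definition RG :: "flow \<Rightarrow> flow" where
  "RG \<Phi> t a b =
     (let u1 = (THE u1. first_shell_solution \<Phi> a b u1)
      in (\<lambda>m. scale_down (inner_flow \<Phi> a u1 t) m + (if m = 0 then u1 t else 0)))"

end

theory Submission
  imports Defs
begin

text \<open>
  Write \<open>u\<close> for the unique first-shell solution attached to \<open>(a, b)\<close>.  The state of
  \<open>RG \<Phi>\<close> at time \<open>t\<close> consists of \<open>u t\<close> in the first shell, followed by the inner state, which is
  \<open>\<Phi>\<close> run from \<open>scale_up a\<close> with boundary \<open>lam * u\<close>, divided by \<open>lam\<close>.  Hence \<open>scale_up\<close> maps the
  state of \<open>RG \<Phi>\<close> at time \<open>t\<close> exactly to the inner state, and this turns the axioms of a
  flow map for \<open>\<Phi>\<close> into statements about first-shell solutions.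

  The semigroup relation holds because a shifted first-shell solution solves the shifted problem,
  to which uniqueness applies.  Causality is less immediate, because the hypothesis of uniqueness
  concerns solutions on the whole half-line and says nothing directly about \<open>[0, t]\<close>.  If \<open>b\<close> and
  \<open>b2\<close> agree on \<open>[0, t]\<close>, take the solution for \<open>b\<close> up to time \<open>t\<close> and continue it by the
  solution of the problem for \<open>b2\<close> restarted at time \<open>t\<close>.  The two pieces have the same value at
  \<open>t\<close> and, both being governed by the same equation there, the same derivative, so the result is
  continuously differentiable and solves the problem for \<open>b2\<close> on the whole half-line
  (\<open>solves_concat\<close>).  Global uniqueness identifies it with the solution for \<open>b2\<close>, which therefore
  agrees with the solution for \<open>b\<close> on \<open>[0, t]\<close>.

  Finally, the equation of the first shell is the defining initial value problem, and the equation
  of shell \<open>n + 1\<close> is that of shell \<open>n\<close> of the inner flow: \<open>dyadic\<close> is homogeneous of degree two,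
  so division of all shells by \<open>lam\<close> leaves one factor \<open>lam\<close>, which raises the wavenumber by
  one level.
\<close>

section \<open>Continuously differentiable functions on the half-line\<close>

lemma derivative_within_halfline_cong:
  assumes "(g has_real_derivative D) (at s within {0..})" "s \<ge> 0"
    and "\<And>r. r \<ge> 0 \<Longrightarrow> g r = h r"
  shows "(h has_real_derivative D) (at s within {0..})"
  using has_field_derivative_transform_within[OF assms(1), of 1 h] assms by auto

lemma derivative_within_halfline_shift:
  fixes g :: "real \<Rightarrow> real"
  assumes "(g has_real_derivative D) (at (t + s) within {0..})" "t \<ge> 0"
  shows "((\<lambda>r. g (t + r)) has_real_derivative D) (at s within {0..})"
proof -
  have "(g has_real_derivative D) (at (t + s) within (+) t ` {0..})"
    by (rule DERIV_subset[OF assms(1)]) (use assms(2) in auto)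
  from DERIV_at_within_shift_lemma[OF this] show ?thesis by (simp add: o_def)
qed

lemma derivative_within_halfline_unique:
  fixes g :: "real \<Rightarrow> real"
  assumes "(g has_real_derivative D) (at s within {0..})"
    and "(g has_real_derivative E) (at s within {0..})" "s \<ge> 0"
  shows "D = E"
proof (rule has_field_derivative_unique[OF assms(1,2)])
  have "at s within {s..} \<le> at s within {0..}"
    by (rule at_le) (use assms(3) in auto)
  moreover have "at s within {s..} \<noteq> bot"
    by (simp add: at_within_Ici_at_right)
  ultimately show "at s within {0..} \<noteq> bot"
    using bot.extremum_unique by force
qed

lemma C1_halfline_cong:
  assumes "g \<in> C1_halfline" "\<And>r. r \<ge> 0 \<Longrightarrow> g r = h r"
  shows "h \<in> C1_halfline"
  using assms derivative_within_halfline_cong[of g _ _ h] unfolding C1_halfline_def by blast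

lemma C1_halfline_cmult:
  assumes "g \<in> C1_halfline"
  shows "(\<lambda>r. c * g r) \<in> C1_halfline"
proof -
  from assms obtain g' where "continuous_on {0..} g'"
    and "\<forall>t\<ge>0. (g has_real_derivative g' t) (at t within {0..})"
    unfolding C1_halfline_def by blast
  then have "continuous_on {0..} (\<lambda>r. c * g' r)"
    and "\<forall>t\<ge>0. ((\<lambda>r. c * g r) has_real_derivative c * g' t) (at t within {0..})"
    by (auto intro: continuous_on_mult_left DERIV_cmult)
  then show ?thesis unfolding C1_halfline_def by blast
qed

lemma C1_halfline_shift:
  assumes "g \<in> C1_halfline" "t \<ge> 0"
  shows "(\<lambda>r. g (t + r)) \<in> C1_halfline"
proof -
  from assms(1) obtain g' where c: "continuous_on {0..} g'"
    and d: "\<forall>t\<ge>0. (g has_real_derivative g' t) (at t within {0..})"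
    unfolding C1_halfline_def by blast
  have "continuous_on {0..} (\<lambda>r. g' (t + r))"
    by (rule continuous_on_compose2[OF c]) (use assms(2) in \<open>auto intro!: continuous_intros\<close>)
  moreover have "\<forall>s\<ge>0. ((\<lambda>r. g (t + r)) has_real_derivative g' (t + s)) (at s within {0..})"
    using d assms(2) by (auto intro!: derivative_within_halfline_shift)
  ultimately show ?thesis unfolding C1_halfline_def by blast
qed

definition concat_at :: "real \<Rightarrow> (real \<Rightarrow> real) \<Rightarrow> (real \<Rightarrow> real) \<Rightarrow> real \<Rightarrow> real" where
  "concat_at t u v = (\<lambda>r. if r \<le> t then u r else v (r - t))"

lemma concat_at_after: "u t = v 0 \<Longrightarrow> r \<ge> 0 \<Longrightarrow> concat_at t u v (t + r) = v r"
  by (auto simp: concat_at_def)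

lemma derivative_concat_at:
  assumes u: "\<And>s. 0 \<le> s \<Longrightarrow> s \<le> t \<Longrightarrow> (u has_real_derivative D s) (at s within {0..})"
    and v: "\<And>s. s \<ge> 0 \<Longrightarrow> (v has_real_derivative E s) (at s within {0..})"
    and match: "u t = v 0" "D t = E 0"
    and t: "t \<ge> 0" and s: "s \<ge> 0"
  shows "(concat_at t u v has_real_derivative concat_at t D E s) (at s within {0..})"
proof -
  have cl: "closure {0..t} \<inter> closure {t..} = {t}" using t by auto
  have v': "((\<lambda>r. v (r - t)) has_real_derivative E (r - t)) (at r within {t..})" if "r \<ge> t" for r
  proof -
    have img: "(+) (- t) ` {t..} = {0..}"
      using image_add_atLeast[of "- t" t] by simp
    have "(v has_real_derivative E (r - t)) (at (- t + r) within (+) (- t) ` {t..})"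
      unfolding img using v[of "r - t"] that by simp
    from DERIV_at_within_shift_lemma[OF this] show ?thesis by (simp add: o_def)
  qed
  have "((\<lambda>r. if r \<in> {0..t} then u r else v (r - t)) has_vector_derivative
     (if s \<in> {0..t} then D s else E (s - t))) (at s within {0..})"
  proof (rule has_vector_derivative_If_within_closures[where T = "{t..}"])
    show "(u has_vector_derivative D s) (at s within {0..t} \<union> closure {0..t} \<inter> closure {t..})"
      if "s \<in> {0..t} \<union> closure {0..t} \<inter> closure {t..}"
    proof -
      have "0 \<le> s" "s \<le> t" using that cl t by auto
      then show ?thesis
        unfolding cl has_real_derivative_iff_has_vector_derivative[symmetric]
        using t by (intro DERIV_subset[OF u]) auto
    qed
    show "((\<lambda>r. v (r - t)) has_vector_derivative E (s - t))
        (at s within {t..} \<union> closure {0..t} \<inter> closure {t..})"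
      if "s \<in> {t..} \<union> closure {0..t} \<inter> closure {t..}"
    proof -
      have "t \<le> s" using that cl by auto
      moreover have "{t..} \<union> {t} = {t..}" by auto
      ultimately show ?thesis
        unfolding cl has_real_derivative_iff_has_vector_derivative[symmetric]
        using v' by simp
    qed
  qed (use s t match in auto)
  then have "((\<lambda>r. if r \<in> {0..t} then u r else v (r - t)) has_real_derivative concat_at t D E s)
      (at s within {0..})"
    using s by (simp add: has_real_derivative_iff_has_vector_derivative concat_at_def)
  then show ?thesis
    by (rule derivative_within_halfline_cong) (use s in \<open>auto simp: concat_at_def\<close>)
qed

lemma C1_halfline_concat_at:
  assumes u: "u \<in> C1_halfline" and v: "v \<in> C1_halfline" and t: "t \<ge> 0" and val: "u t = v 0"
    and du: "(u has_real_derivative d) (at t within {0..})"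
    and dv: "(v has_real_derivative d) (at 0 within {0..})"
  shows "concat_at t u v \<in> C1_halfline"
proof -
  from u obtain D where Dc: "continuous_on {0..} D"
    and D: "\<And>s. s \<ge> 0 \<Longrightarrow> (u has_real_derivative D s) (at s within {0..})"
    unfolding C1_halfline_def by blast
  from v obtain E where Ec: "continuous_on {0..} E"
    and E: "\<And>s. s \<ge> 0 \<Longrightarrow> (v has_real_derivative E s) (at s within {0..})"
    unfolding C1_halfline_def by blast
  have DE: "D t = E 0"
    using derivative_within_halfline_unique[OF D du] derivative_within_halfline_unique[OF E dv] t
    by simp
  have "continuous_on {0..} (concat_at t D E)"
    unfolding concat_at_def
  proof (rule continuous_on_cases_1)
    show "continuous_on {r \<in> {0..}. r \<le> t} D"
      by (rule continuous_on_subset[OF Dc]) auto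
    show "continuous_on {r \<in> {0..}. t \<le> r} (\<lambda>r. E (r - t))"
      by (rule continuous_on_compose2[OF Ec]) (auto intro!: continuous_intros)
  qed (simp add: DE)
  moreover have "\<forall>s\<ge>0. (concat_at t u v has_real_derivative concat_at t D E s) (at s within {0..})"
    using derivative_concat_at[OF D E val DE t] by simp
  ultimately show ?thesis unfolding C1_halfline_def by blast
qed

section \<open>Square-summable sequences and scaling\<close>

lemma square_summable_cmult: "a \<in> square_summable \<Longrightarrow> (\<lambda>m. c * a m) \<in> square_summable"
  by (auto simp: square_summable_def power_mult_distrib intro: summable_mult)

lemma square_summable_tail: "(\<lambda>m. a (Suc m)) \<in> square_summable \<longleftrightarrow> a \<in> square_summable"
  using summable_Suc_iff[of "\<lambda>m. (a m)\<^sup>2"] by (simp add: square_summable_def)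

lemma square_summable_scale_up: "a \<in> square_summable \<Longrightarrow> scale_up a \<in> square_summable"
  using square_summable_cmult[of "\<lambda>m. a (Suc m)" lam]
  by (simp add: square_summable_tail scale_up_def[abs_def])

text \<open>The state of the renormalized flow with first shell \<open>x\<close> and inner state \<open>w\<close>.\<close>

definition prepend_shell :: "real \<Rightarrow> (nat \<Rightarrow> real) \<Rightarrow> nat \<Rightarrow> real" where
  "prepend_shell x w = shell x (\<lambda>m. w m / lam)"

lemma prepend_shell_0 [simp]: "prepend_shell x w 0 = x"
  by (simp add: prepend_shell_def shell_def)

lemma prepend_shell_Suc [simp]: "prepend_shell x w (Suc m) = w m / lam"
  by (simp add: prepend_shell_def shell_def)

lemma scale_up_prepend_shell [simp]: "scale_up (prepend_shell x w) = w"
  by (simp add: scale_up_def lam_def fun_eq_iff)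

lemma prepend_shell_scale_up [simp]: "prepend_shell (a 0) (scale_up a) = a"
proof
  show "prepend_shell (a 0) (scale_up a) m = a m" for m
    by (cases m) (simp_all add: scale_up_def lam_def)
qed

lemma square_summable_prepend_shell:
  assumes "w \<in> square_summable"
  shows "prepend_shell x w \<in> square_summable"
proof -
  have "(\<lambda>m. prepend_shell x w (Suc m)) \<in> square_summable"
    using square_summable_cmult[OF assms, of "1 / lam"] by simp
  then show ?thesis by (simp only: square_summable_tail)
qed

section \<open>First-shell solutions\<close>

text \<open>A first-shell solution without the normalisation at negative times.  Shifts and
  concatenations do not respect that normalisation, so it is separated from the dynamics.\<close>

definition solves ::
  "flow \<Rightarrow> (nat \<Rightarrow> real) \<Rightarrow> (real \<Rightarrow> real) \<Rightarrow> (real \<Rightarrow> real) \<Rightarrow> bool" where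
  "solves \<Phi> a b u \<longleftrightarrow> u \<in> C1_halfline \<and> u 0 = a 0 \<and>
     (\<forall>t\<ge>0. (u has_real_derivative
        wavenumber 1 * dyadic (b t) (u t) (inner_flow \<Phi> a u t 0 / lam)) (at t within {0..}))"

lemma first_shell_solution_iff:
  "first_shell_solution \<Phi> a b u \<longleftrightarrow> solves \<Phi> a b u \<and> u \<in> extensional {0..}"
  by (auto simp: first_shell_solution_def solves_def)

context
  fixes \<Phi> :: flow
  assumes flow: "flow_map \<Phi>"
begin

lemma flow_initial: "a \<in> square_summable \<Longrightarrow> b \<in> C1_halfline \<Longrightarrow> \<Phi> 0 a b = a"
  using flow[unfolded flow_map_def, THEN conjunct2, THEN conjunct1] by blast

lemma flow_square_summable:
  "a \<in> square_summable \<Longrightarrow> b \<in> C1_halfline \<Longrightarrow> t \<ge> 0 \<Longrightarrow> \<Phi> t a b \<in> square_summable"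
  using flow[unfolded flow_map_def, THEN conjunct1] by blast

lemma flow_causal:
  assumes "a \<in> square_summable" "b \<in> C1_halfline" "b2 \<in> C1_halfline" "t \<ge> 0"
    and "\<And>s. 0 \<le> s \<Longrightarrow> s \<le> t \<Longrightarrow> b s = b2 s"
  shows "\<Phi> t a b = \<Phi> t a b2"
  using flow[unfolded flow_map_def, THEN conjunct2, THEN conjunct2, THEN conjunct1,
      rule_format, OF assms(4,1,2,3)] assms(5) by simp

lemma flow_semigroup:
  "a \<in> square_summable \<Longrightarrow> b \<in> C1_halfline \<Longrightarrow> t \<ge> 0 \<Longrightarrow> s \<ge> 0 \<Longrightarrow>
     \<Phi> (t + s) a b = \<Phi> s (\<Phi> t a b) (\<lambda>r. b (t + r))"
  using flow[unfolded flow_map_def, THEN conjunct2, THEN conjunct2, THEN conjunct2] by blast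

lemma inner_flow_initial:
  "a \<in> square_summable \<Longrightarrow> u \<in> C1_halfline \<Longrightarrow> inner_flow \<Phi> a u 0 = scale_up a"
  by (simp add: inner_flow_def flow_initial square_summable_scale_up C1_halfline_cmult)

lemma inner_flow_square_summable:
  "a \<in> square_summable \<Longrightarrow> u \<in> C1_halfline \<Longrightarrow> t \<ge> 0 \<Longrightarrow> inner_flow \<Phi> a u t \<in> square_summable"
  by (simp add: inner_flow_def flow_square_summable square_summable_scale_up C1_halfline_cmult)

lemma inner_flow_causal:
  assumes "a \<in> square_summable" "u \<in> C1_halfline" "v \<in> C1_halfline" "t \<ge> 0"
    and "\<And>s. 0 \<le> s \<Longrightarrow> s \<le> t \<Longrightarrow> u s = v s"
  shows "inner_flow \<Phi> a u t = inner_flow \<Phi> a v t"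
  unfolding inner_flow_def
  by (rule flow_causal) (use assms in \<open>simp_all add: square_summable_scale_up C1_halfline_cmult\<close>)

text \<open>Restarting \<open>RG \<Phi>\<close> from its state at time \<open>t\<close> restarts the inner flow from the inner
  state at time \<open>t\<close>, because \<open>scale_up\<close> recovers the latter.\<close>

lemma inner_flow_restart:
  assumes "a \<in> square_summable" "u \<in> C1_halfline" "t \<ge> 0" "s \<ge> 0"
  shows "inner_flow \<Phi> (prepend_shell x (inner_flow \<Phi> a u t)) (\<lambda>r. u (t + r)) s
    = inner_flow \<Phi> a u (t + s)"
  using flow_semigroup[of "scale_up a" "\<lambda>r. lam * u r" t s] assms
  by (simp add: inner_flow_def square_summable_scale_up C1_halfline_cmult)

lemma solves_cong:
  assumes a: "a \<in> square_summable" and u: "solves \<Phi> a b u" and eq: "\<And>r. r \<ge> 0 \<Longrightarrow> u r = v r"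
  shows "solves \<Phi> a b v"
proof -
  have uC: "u \<in> C1_halfline" using u by (simp add: solves_def)
  have vC: "v \<in> C1_halfline" by (rule C1_halfline_cong[OF uC eq])
  have "(v has_real_derivative
      wavenumber 1 * dyadic (b t) (v t) (inner_flow \<Phi> a v t 0 / lam)) (at t within {0..})"
    if "t \<ge> 0" for t
  proof -
    have "inner_flow \<Phi> a u t = inner_flow \<Phi> a v t"
      by (rule inner_flow_causal[OF a uC vC that eq])
    moreover have "(u has_real_derivative
        wavenumber 1 * dyadic (b t) (u t) (inner_flow \<Phi> a u t 0 / lam)) (at t within {0..})"
      using u that by (simp add: solves_def)
    ultimately show ?thesis
      using derivative_within_halfline_cong[OF _ that eq] eq[OF that] by simp
  qed
  then show ?thesis using u vC eq[of 0] by (simp add: solves_def)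
qed

lemma solves_shift:
  assumes a: "a \<in> square_summable" and u: "solves \<Phi> a b u" and t: "t \<ge> 0"
  shows "solves \<Phi> (prepend_shell (u t) (inner_flow \<Phi> a u t)) (\<lambda>r. b (t + r)) (\<lambda>r. u (t + r))"
proof -
  have uC: "u \<in> C1_halfline" using u by (simp add: solves_def)
  show ?thesis
    unfolding solves_def
    using u t by (auto simp: inner_flow_restart[OF a uC t] C1_halfline_shift[OF uC t] solves_def
        intro!: derivative_within_halfline_shift)
qed

text \<open>Causality of the inner flow makes the concatenation solve the equation up to time \<open>t\<close>, and
  the semigroup relation makes it solve the equation afterwards.  At time \<open>t\<close> both pieces have the
  same derivative, since the restarted inner flow begins in the state in which the first one
  stopped and \<open>b t = b2 t\<close>.\<close>

lemma solves_concat: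
  assumes a: "a \<in> square_summable" and t: "t \<ge> 0"
    and u: "solves \<Phi> a b u"
    and v: "solves \<Phi> (prepend_shell (u t) (inner_flow \<Phi> a u t)) (\<lambda>r. b2 (t + r)) v"
    and b: "\<And>s. 0 \<le> s \<Longrightarrow> s \<le> t \<Longrightarrow> b s = b2 s"
  shows "solves \<Phi> a b2 (concat_at t u v)"
proof -
  let ?w = "concat_at t u v" and ?a = "prepend_shell (u t) (inner_flow \<Phi> a u t)"
  define D where "D s = wavenumber 1 * dyadic (b s) (u s) (inner_flow \<Phi> a u s 0 / lam)" for s
  define E where "E s = wavenumber 1 * dyadic (b2 (t + s)) (v s) (inner_flow \<Phi> ?a v s 0 / lam)" for s
  have uC: "u \<in> C1_halfline" and u0: "u 0 = a 0"
    and D: "\<And>s. s \<ge> 0 \<Longrightarrow> (u has_real_derivative D s) (at s within {0..})"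
    using u by (auto simp: solves_def D_def)
  have vC: "v \<in> C1_halfline" and v0: "u t = v 0"
    and E: "\<And>s. s \<ge> 0 \<Longrightarrow> (v has_real_derivative E s) (at s within {0..})"
    using v by (auto simp: solves_def E_def)
  have a': "?a \<in> square_summable"
    by (intro square_summable_prepend_shell inner_flow_square_summable a uC t)
  have DE: "D t = E 0"
    using b[of t] t inner_flow_initial[OF a' vC] by (simp add: D_def E_def flip: v0)
  have wC: "?w \<in> C1_halfline"
    by (rule C1_halfline_concat_at[OF uC vC t v0 D[OF t]]) (simp add: DE E)
  have before: "inner_flow \<Phi> a ?w s = inner_flow \<Phi> a u s" if "0 \<le> s" "s \<le> t" for s
    by (rule inner_flow_causal[OF a wC uC]) (use that in \<open>auto simp: concat_at_def\<close>)
  have after: "inner_flow \<Phi> a ?w (t + s) = inner_flow \<Phi> ?a v s" if "s \<ge> 0" for s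
  proof -
    have "inner_flow \<Phi> ?a v s = inner_flow \<Phi> ?a (\<lambda>r. ?w (t + r)) s"
      by (rule inner_flow_causal[OF a' vC C1_halfline_shift[OF wC t] that])
        (simp add: concat_at_after v0)
    also have "\<dots> = inner_flow \<Phi> a ?w (t + s)"
      using inner_flow_restart[OF a wC t that, of "u t"] before[of t] t by simp
    finally show ?thesis by simp
  qed
  have rhs: "wavenumber 1 * dyadic (b2 s) (?w s) (inner_flow \<Phi> a ?w s 0 / lam) = concat_at t D E s"
    if "s \<ge> 0" for s
  proof (cases "s \<le> t")
    case True
    then show ?thesis using that before[of s] b[of s] by (simp add: D_def concat_at_def)
  next
    case False
    then show ?thesis using after[of "s - t"] by (simp add: E_def concat_at_def)
  qed
  show ?thesis
    using derivative_concat_at[OF D E v0 DE t] rhs wC t u0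
    by (auto simp: solves_def concat_at_def[of t u v])
qed

end

section \<open>The renormalized flow\<close>

definition first_shell :: "flow \<Rightarrow> (nat \<Rightarrow> real) \<Rightarrow> (real \<Rightarrow> real) \<Rightarrow> real \<Rightarrow> real" where
  "first_shell \<Phi> a b = (THE u. first_shell_solution \<Phi> a b u)"

lemma RG_eq:
  "RG \<Phi> t a b
    = prepend_shell (first_shell \<Phi> a b t) (inner_flow \<Phi> a (first_shell \<Phi> a b) t)"
proof
  show "RG \<Phi> t a b m
    = prepend_shell (first_shell \<Phi> a b t) (inner_flow \<Phi> a (first_shell \<Phi> a b) t) m" for m
    by (cases m) (simp_all add: RG_def Let_def first_shell_def scale_down_def)
qed

context
  fixes \<Phi> :: flow
  assumes renorm: "renormalizable \<Phi>"
begin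

lemma flow: "flow_map \<Phi>"
  using renorm by (simp add: renormalizable_def)

lemma first_shell_solves:
  assumes "a \<in> square_summable" "b \<in> C1_halfline"
  shows "solves \<Phi> a b (first_shell \<Phi> a b)"
proof -
  have "\<exists>!u. first_shell_solution \<Phi> a b u"
    using renorm assms by (simp add: renormalizable_def)
  from theI'[OF this] show ?thesis
    by (simp add: first_shell_solution_iff first_shell_def)
qed

lemma first_shell_unique:
  assumes a: "a \<in> square_summable" and b: "b \<in> C1_halfline" and u: "solves \<Phi> a b u"
    and r: "r \<ge> 0"
  shows "first_shell \<Phi> a b r = u r"
proof -
  have "solves \<Phi> a b (restrict u {0..})"
    by (rule solves_cong[OF flow a u]) simp
  then have "first_shell_solution \<Phi> a b (restrict u {0..})"
    by (simp add: first_shell_solution_iff)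
  moreover have "\<exists>!u. first_shell_solution \<Phi> a b u"
    using renorm a b by (simp add: renormalizable_def)
  ultimately have "first_shell \<Phi> a b = restrict u {0..}"
    unfolding first_shell_def by (rule the1_equality[rotated])
  then show ?thesis using r by simp
qed

lemma first_shell_C1: "a \<in> square_summable \<Longrightarrow> b \<in> C1_halfline \<Longrightarrow> first_shell \<Phi> a b \<in> C1_halfline"
  using first_shell_solves by (simp add: solves_def)

lemma RG_square_summable:
  "a \<in> square_summable \<Longrightarrow> b \<in> C1_halfline \<Longrightarrow> t \<ge> 0 \<Longrightarrow> RG \<Phi> t a b \<in> square_summable"
  by (simp add: RG_eq square_summable_prepend_shell inner_flow_square_summable[OF flow] first_shell_C1)

lemma RG_initial:
  assumes "a \<in> square_summable" "b \<in> C1_halfline"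
  shows "RG \<Phi> 0 a b = a"
  using first_shell_solves[OF assms] inner_flow_initial[OF flow assms(1) first_shell_C1[OF assms]]
  by (simp add: RG_eq solves_def)

lemma RG_causal:
  assumes a: "a \<in> square_summable" and b: "b \<in> C1_halfline" and b2: "b2 \<in> C1_halfline"
    and t: "t \<ge> 0" and eq: "\<And>s. 0 \<le> s \<Longrightarrow> s \<le> t \<Longrightarrow> b s = b2 s"
  shows "RG \<Phi> t a b = RG \<Phi> t a b2"
proof -
  let ?u = "first_shell \<Phi> a b"
  let ?v = "first_shell \<Phi> (RG \<Phi> t a b) (\<lambda>r. b2 (t + r))"
  have "solves \<Phi> (RG \<Phi> t a b) (\<lambda>r. b2 (t + r)) ?v"
    by (intro first_shell_solves RG_square_summable C1_halfline_shift a b b2 t)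
  then have "solves \<Phi> a b2 (concat_at t ?u ?v)"
    by (intro solves_concat[OF flow a t first_shell_solves[OF a b] _ eq]) (simp_all add: RG_eq)
  then have same: "first_shell \<Phi> a b2 s = ?u s" if "0 \<le> s" "s \<le> t" for s
    using first_shell_unique[OF a b2] that by (simp add: concat_at_def)
  have "inner_flow \<Phi> a ?u t = inner_flow \<Phi> a (first_shell \<Phi> a b2) t"
    by (rule inner_flow_causal[OF flow a])
      (simp_all add: first_shell_C1 a b b2 t same)
  then show ?thesis using same t by (simp add: RG_eq)
qed

lemma RG_semigroup:
  assumes a: "a \<in> square_summable" and b: "b \<in> C1_halfline" and t: "t \<ge> 0" and s: "s \<ge> 0"
  shows "RG \<Phi> (t + s) a b = RG \<Phi> s (RG \<Phi> t a b) (\<lambda>r. b (t + r))"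
proof -
  let ?u = "first_shell \<Phi> a b" and ?a = "RG \<Phi> t a b" and ?b = "\<lambda>r. b (t + r)"
  have a': "?a \<in> square_summable" and b': "?b \<in> C1_halfline"
    by (simp_all add: RG_square_summable C1_halfline_shift a b t)
  have uC: "?u \<in> C1_halfline" by (rule first_shell_C1[OF a b])
  have "solves \<Phi> ?a ?b (\<lambda>r. ?u (t + r))"
    unfolding RG_eq by (rule solves_shift[OF flow a first_shell_solves[OF a b] t])
  note shifted = first_shell_unique[OF a' b' this]
  have "inner_flow \<Phi> ?a (first_shell \<Phi> ?a ?b) s = inner_flow \<Phi> ?a (\<lambda>r. ?u (t + r)) s"
    by (rule inner_flow_causal[OF flow a' first_shell_C1[OF a' b'] C1_halfline_shift[OF uC t] s])
      (rule shifted)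
  also have "\<dots> = inner_flow \<Phi> a ?u (t + s)"
    unfolding RG_eq by (rule inner_flow_restart[OF flow a uC t s])
  finally show ?thesis
    using shifted[OF s] RG_eq[of \<Phi> "t + s" a b] RG_eq[of \<Phi> s ?a ?b] by simp
qed

lemma flow_map_RG: "flow_map (RG \<Phi>)"
  unfolding flow_map_def
proof (intro conjI ballI allI impI)
  fix t a b b2
  assume "0 \<le> t" "a \<in> square_summable" "b \<in> C1_halfline" "b2 \<in> C1_halfline"
    and "\<forall>s\<in>{0..t}. b s = b2 s"
  then show "RG \<Phi> t a b = RG \<Phi> t a b2"
    by (intro RG_causal) simp_all
qed (simp_all add: RG_square_summable RG_initial RG_semigroup)

end

lemma dyadic_scale: "dyadic (c * x) (c * y) (c * z) = c\<^sup>2 * dyadic x y z"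
  by (simp add: dyadic_def power2_eq_square algebra_simps)

theorem proposition1:
  fixes N :: nat and \<Phi> :: flow
  assumes "renormalizable \<Phi>"
    and "level_regularization N \<Phi>"
  shows "level_regularization (N + 1) (RG \<Phi>)"
proof -
  have "((\<lambda>s. shell (b s) (RG \<Phi> s a b) n) has_real_derivative
      wavenumber n * dyadic (shell (b t) (RG \<Phi> t a b) (n - 1)) (shell (b t) (RG \<Phi> t a b) n)
        (shell (b t) (RG \<Phi> t a b) (n + 1))) (at t within {0..})"
    if a: "a \<in> square_summable" and b: "b \<in> C1_halfline" and n: "n \<in> {1..N + 1}" and t: "t \<ge> 0"
    for a b n t
  proof -
    define u where "u = first_shell \<Phi> a b"
    define w where "w s = shell (lam * u s) (inner_flow \<Phi> a u s)" for s
    have u: "solves \<Phi> a b u" and uC: "u \<in> C1_halfline"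
      unfolding u_def using first_shell_solves first_shell_C1 assms(1) a b by blast+
    have RG0: "RG \<Phi> s a b 0 = u s" for s
      by (simp add: RG_eq u_def)
    \<comment> \<open>Shell \<open>m + 1\<close> of the renormalized flow is shell \<open>m\<close> of the inner flow over \<open>lam\<close>; for
      \<open>m = 0\<close> the latter is the inner boundary value \<open>lam * u s\<close>.\<close>
    have RG_w: "RG \<Phi> s a b m = 1 / lam * w s m" for s m
      by (cases m) (simp_all add: RG_eq u_def w_def shell_def lam_def)
    have inner: "((\<lambda>s. w s m) has_real_derivative
        wavenumber m * dyadic (w t (m - 1)) (w t m) (w t (m + 1))) (at t within {0..})"
      if "m \<in> {1..N}" for m
      using assms(2)[unfolded level_regularization_def Let_def, THEN conjunct2, rule_format,
          OF square_summable_scale_up[OF a] C1_halfline_cmult[OF uC, of lam] that t]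
      unfolding w_def inner_flow_def .
    obtain m where m: "n = Suc m" using n by (cases n) auto
    show ?thesis
    proof (cases m)
      case 0
      then show ?thesis
        using u t m by (simp add: solves_def shell_def RG0 RG_eq u_def)
    next
      case (Suc j)
      have "m \<in> {1..N}" using n m Suc by simp
      from DERIV_cmult[OF inner[OF this], of "1 / lam"]
      have "((\<lambda>s. 1 / lam * w s m) has_real_derivative
          wavenumber n * dyadic (1 / lam * w t (m - 1)) (1 / lam * w t m) (1 / lam * w t (m + 1)))
          (at t within {0..})"
        unfolding dyadic_scale
        by (simp add: m wavenumber_def lam_def power2_eq_square)
      then show ?thesis
        by (simp add: m Suc shell_def RG_w)
    qed
  qed
  with flow_map_RG[OF assms(1)] show ?thesis
    unfolding level_regularization_def Let_def by blast
qed

end
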